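(* Let $T,K\in\mathbb N$ and $1<a\le e$. The function $F_{T,K,a}:\mathbb R^T\to\mathbb R$ defined in the context satisfies: 1. For all $x\in\mathbb R^T$, $\mathrm{supp}(\nabla F_{T,K,a}(x))\subseteq\{1,\dots,\mathrm{prog}^K(x)+1\}\cup\mathrm{supp}(x)$. 2. For all $x\in\mathbb R^T$, if $\mathrm{prog}^K(x)<T$, then $\|\nabla F_{T,K,a}(x)\|>1$.
   Context: $\mathbb N=\{1,2,\dots\}$ and $\|\cdot\|$ is the Euclidean norm. For $x=(x_1,\dots,x_T)\in\mathbb R^T$ set by convention $x_0=x_{-1}=\dots=x_{-K+1}\equiv1$. Define $$F_{T,K,a}(x)=-\sum_{i=1}^T\Psi_a(x_{i-K})\cdots\Psi_a(x_{i-2})\Psi_a(x_{i-1})\Phi(x_i)+\sum_{i=1}^T\Gamma(x_i),$$ where $$\Psi_a(x)=\begin{cases}0,&x\le 1/2,\\ \exp\!\left(\log a\cdot\left(1-\frac{1}{(2x-1)^2}\right)\right),&x>1/2,\end{cases}\qquad \Phi(x)=\sqrt e\int_{-\infty}^x e^{-t^2/2}\,dt,\qquad \Gamma(x)=\begin{cases}-x\,e^{1/x+1},&x<0,\\0,&x\ge0.\end{cases}$$ Also $$\mathrm{prog}^K(x)=\max\{i\in\{0,1,\dots,T\}:\ x_i\ne0,\ x_{i-1}\ne0,\ \dots,\ x_{i-K+1}\ne0\}$$ (with the same convention $x_0=\dots=x_{-K+1}\equiv1$), and $\mathrm{supp}(v)=\{i\in\{1,\dots,T\}:v_i\ne0\}$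 for $v\in\mathbb R^T$. *)

theory Defs
  imports "HOL-Analysis.Analysis"
begin

text \<open>
  The space \<open>\<real>\<^sup>T\<close> is \<^typ>\<open>real ^ 'n\<close> for a finite linearly ordered index type
  with \<open>T = CARD('n)\<close>; the order of the index type gives the numbering
  \<open>1, \<dots>, T\<close> of the coordinates.
\<close>

definition idx :: "nat \<Rightarrow> 'n::{finite,linorder}" where
  "idx i = sorted_list_of_set UNIV ! (i - 1)"

lemma bij_betw_idx: "bij_betw (idx :: nat \<Rightarrow> 'n::{finite,linorder}) {1..CARD('n)} UNIV"
proof -
  let ?xs = "sorted_list_of_set (UNIV :: 'n set)"
  have "bij_betw (\<lambda>i. i - 1) {1..CARD('n)} {..<CARD('n)}"
    by (rule bij_betw_byWitness[where f' = Suc]) auto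
  moreover have "bij_betw ((!) ?xs) {..<CARD('n)} UNIV"
    by (rule bij_betw_nth) auto
  ultimately show ?thesis
    unfolding idx_def using bij_betw_trans by (fastforce simp: comp_def)
qed

lemma strict_mono_on_idx:
  "strict_mono_on {1..CARD('n)} (idx :: nat \<Rightarrow> 'n::{finite,linorder})"
proof (rule strict_mono_onI)
  fix i j assume "i \<in> {1..CARD('n)}" "j \<in> {1..CARD('n)}" "i < j"
  then show "(idx i :: 'n) < idx j"
    unfolding idx_def by (auto intro!: sorted_wrt_nth_less[OF strict_sorted_list_of_set])
qed

text \<open>
  The coordinate \<open>x\<^sub>i\<close>, with the convention \<open>x\<^sub>i = 1\<close> for \<open>i \<le> 0\<close>. Indices above
  \<open>T\<close> never occur in the definitions below.
\<close>

definition coord :: "real ^ 'n::{finite,linorder} \<Rightarrow> int \<Rightarrow> real" where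
  "coord x i = (if i \<le> 0 then 1 else x $ idx (nat i))"

definition Psi :: "real \<Rightarrow> real \<Rightarrow> real" where
  "Psi a x = (if x \<le> 1 / 2 then 0 else exp (ln a * (1 - 1 / (2 * x - 1)\<^sup>2)))"

definition Phi :: "real \<Rightarrow> real" where
  "Phi x = sqrt (exp 1) * integral {..x} (\<lambda>t. exp (- (t\<^sup>2) / 2))"

definition Gam :: "real \<Rightarrow> real" where
  "Gam x = (if x < 0 then - x * exp (1 / x + 1) else 0)"

definition F :: "nat \<Rightarrow> real \<Rightarrow> real ^ 'n::{finite,linorder} \<Rightarrow> real" where
  "F K a x =
     - (\<Sum>i=1..CARD('n). (\<Prod>k=1..K. Psi a (coord x (int i - int k))) * Phi (coord x (int i)))
     + (\<Sum>i=1..CARD('n). Gam (coord x (int i)))"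

definition prog :: "nat \<Rightarrow> real ^ 'n::{finite,linorder} \<Rightarrow> nat" where
  "prog K x = Max {i \<in> {0..CARD('n)}. \<forall>k<K. coord x (int i - int k) \<noteq> 0}"

definition supp :: "real ^ 'n::{finite,linorder} \<Rightarrow> nat set" where
  "supp v = {i \<in> {1..CARD('n)}. v $ idx i \<noteq> 0}"

definition gradient :: "('a::real_inner \<Rightarrow> real) \<Rightarrow> 'a \<Rightarrow> 'a" where
  "gradient f x = (THE D. GDERIV f x :> D)"

lemma gradient_eqI:
  assumes "GDERIV f x :> D"
  shows "gradient f x = D"
  unfolding gradient_def
proof (rule the_equality[where P = "\<lambda>D. GDERIV f x :> D", OF assms])
  fix E assume "GDERIV f x :> E"
  then have "(\<lambda>h. inner h E) = (\<lambda>h. inner h D)"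
    using assms unfolding gderiv_def by (rule has_derivative_unique)
  then have "inner (E - D) (E - D) = 0"
    by (metis inner_diff_right right_minus_eq)
  then show "E = D" by simp
qed

end

theory Submission
  imports "HOL-Probability.Distributions" Defs
begin

text \<open>
  Every term of every partial derivative of \<open>F\<close> is nonpositive, so nothing cancels. If \<open>x\<^sub>j = 0\<close>
  and \<open>j > prog + 1\<close>, then \<open>\<Psi>'(0) = \<Gamma>'(0) = 0\<close> and one of the factors \<open>\<Psi>(x\<^bsub>j-k\<^esub>)\<close> in front of
  \<open>\<Phi>'(x\<^sub>j)\<close> vanishes. If \<open>prog < T\<close>, some coordinate is zero; at the first coordinate \<open>x\<^sub>j < 1\<close>
  all preceding ones are at least \<open>1\<close>, so the factors \<open>\<Psi>\<close> are at least \<open>1\<close> and the partial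
  derivative is at most \<open>\<Gamma>'(x\<^sub>j) - \<Phi>'(x\<^sub>j)\<close>. This is below \<open>-1\<close> because \<open>\<Phi>' > 1\<close> on
  \<open>(-1, 1)\<close> and \<open>\<Gamma>' < -1\<close> on \<open>(-\<infinity>, -1]\<close>.
\<close>

section \<open>Derivatives at the gluing points of piecewise functions\<close>

text \<open>The difference quotient is bounded by \<open>C * \<bar>y - x\<bar>\<close>. This treats
  both sides at once where the cases meet: at 1/2 for \<open>Psi\<close>, at 0 for
  \<open>Gam\<close>.\<close>

lemma has_real_derivative_0_if_quadratic_bound:
  fixes f :: "real \<Rightarrow> real"
  assumes "\<And>y. \<bar>f y - f x\<bar> \<le> C * (y - x)\<^sup>2"
  shows "(f has_real_derivative 0) (at x)"
  unfolding has_field_derivative_iff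
proof (rule Lim_null_comparison)
  show "\<forall>\<^sub>F y in at x. norm ((f y - f x) / (y - x)) \<le> C * \<bar>y - x\<bar>"
    unfolding eventually_at_filter
  proof (rule always_eventually, intro allI impI)
    fix y assume "y \<noteq> x"
    then show "norm ((f y - f x) / (y - x)) \<le> C * \<bar>y - x\<bar>"
      using assms[of y] by (simp add: abs_divide divide_simps power2_eq_square mult.assoc)
  qed
  show "(\<lambda>y. C * \<bar>y - x\<bar>) \<midarrow>x\<rightarrow> 0"
    by (auto intro!: tendsto_eq_intros)
qed

text \<open>Supplies the quadratic bounds: \<open>s\<close> is of order
  \<open>1 / (y - x)\<^sup>2\<close> for \<open>Psi\<close>, while for \<open>Gam\<close> it is
  \<open>- 1 / y\<close> and the factor \<open>- y\<close> adds the second order.\<close>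

lemma exp_minus_le_inverse:
  fixes s :: real
  assumes "s > 0"
  shows "exp (- s) \<le> 1 / s"
proof -
  have "s \<le> exp s"
    using exp_ge_add_one_self[of s] by linarith
  then show ?thesis
    using assms by (simp add: exp_minus divide_simps)
qed

section \<open>The function \<open>Psi\<close>\<close>

definition dPsi :: "real \<Rightarrow> real \<Rightarrow> real" where
  "dPsi a x = (if x \<le> 1 / 2 then 0 else Psi a x * (4 * ln a / (2 * x - 1) ^ 3))"

lemma Psi_nonneg: "Psi a x \<ge> 0"
  by (simp add: Psi_def)

lemma Psi_0 [simp]: "Psi a 0 = 0"
  by (simp add: Psi_def)

lemma Psi_ge_1:
  assumes "1 < a" "1 \<le> x"
  shows "1 \<le> Psi a x"
proof -
  have "1 \<le> (2 * x - 1)\<^sup>2"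
    using assms by (intro one_le_power) simp
  then show ?thesis
    using assms by (simp add: Psi_def)
qed

lemma dPsi_0 [simp]: "dPsi a 0 = 0"
  by (simp add: dPsi_def)

lemma dPsi_nonneg:
  assumes "1 < a"
  shows "0 \<le> dPsi a x"
  using assms by (auto simp: dPsi_def intro!: mult_nonneg_nonneg divide_nonneg_nonneg Psi_nonneg)

lemma Psi_has_real_derivative:
  assumes "1 < a"
  shows "(Psi a has_real_derivative dPsi a x) (at x)"
proof (cases x "1 / 2 :: real" rule: linorder_cases)
  case less
  have "((\<lambda>x. 0) has_real_derivative 0) (at x)"
    by simp
  then have "(Psi a has_real_derivative 0) (at x)"
    by (rule has_field_derivative_transform_within_open[of _ _ _ "{..<1 / 2}"])
       (use less in \<open>auto simp: Psi_def\<close>)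
  then show ?thesis
    using less by (simp add: dPsi_def)
next
  case equal
  have L: "ln a > 0"
    using assms by simp
  \<comment> \<open>For \<open>y > 1 / 2\<close> the value is \<open>a * exp (- s)\<close> with
    \<open>s\<close> as below, hence at most \<open>a / s\<close>; the 4 comes from
    \<open>2 * y - 1 = 2 * (y - x)\<close>.\<close>
  have "\<bar>Psi a y - Psi a x\<bar> \<le> 4 * a / ln a * (y - x)\<^sup>2" for y
  proof (cases "y \<le> 1 / 2")
    case True
    then show ?thesis
      using L assms equal by (simp add: Psi_def)
  next
    case False
    define s where "s = ln a / (2 * y - 1)\<^sup>2"
    have s: "s > 0"
      using False L by (simp add: s_def)
    have "ln a * (1 - 1 / (2 * y - 1)\<^sup>2) = ln a + - s"
      by (simp add: s_def algebra_simps)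
    then have "Psi a y = exp (ln a) * exp (- s)"
      using False by (simp add: Psi_def exp_add flip: exp_add)
    also have "\<dots> \<le> a * (1 / s)"
      using exp_minus_le_inverse[OF s] assms by (intro mult_mono) auto
    also have "\<dots> = a / ln a * (2 * (y - x))\<^sup>2"
    proof -
      have "2 * y - 1 = 2 * (y - x)"
        using equal by simp
      then show ?thesis
        unfolding s_def by simp
    qed
    also have "\<dots> = 4 * a / ln a * (y - x)\<^sup>2"
      unfolding power_mult_distrib by simp
    finally have "Psi a y \<le> 4 * a / ln a * (y - x)\<^sup>2" .
    moreover have "Psi a x = 0"
      using equal by (simp add: Psi_def)
    ultimately show ?thesis
      using Psi_nonneg[of a y] by simp
  qed
  then have "(Psi a has_real_derivative 0) (at x)"
    by (rule has_real_derivative_0_if_quadratic_bound)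
  moreover have "dPsi a x = 0"
    using equal by (simp add: dPsi_def)
  ultimately show ?thesis
    by simp
next
  case greater
  define u where "u = 2 * x - 1"
  have u: "u > 0"
    using greater by (simp add: u_def)
  have "((\<lambda>x. 1 / (2 * x - 1)\<^sup>2) has_real_derivative - (4 * u) / (u\<^sup>2)\<^sup>2) (at x)"
    using greater by (auto intro!: derivative_eq_intros simp: u_def power2_eq_square)
  also have "- (4 * u) / (u\<^sup>2)\<^sup>2 = - 4 / u ^ 3"
    using u by (simp add: divide_simps eval_nat_numeral)
  finally have *: "((\<lambda>x. 1 / (2 * x - 1)\<^sup>2) has_real_derivative - 4 / (2 * x - 1) ^ 3) (at x)"
    unfolding u_def .
  have "((\<lambda>x. exp (ln a * (1 - 1 / (2 * x - 1)\<^sup>2))) has_real_derivative dPsi a x) (at x)"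
    using greater * by (auto intro!: derivative_eq_intros *[THEN DERIV_cong] simp: dPsi_def Psi_def)
  then show ?thesis
    by (rule has_field_derivative_transform_within_open[of _ _ _ "{1 / 2<..}"])
       (use greater in \<open>auto simp: Psi_def\<close>)
qed

section \<open>The function \<open>Phi\<close>\<close>

definition dPhi :: "real \<Rightarrow> real" where
  "dPhi x = sqrt (exp 1) * exp (- (x\<^sup>2) / 2)"

lemma dPhi_nonneg: "0 \<le> dPhi x"
  by (simp add: dPhi_def)

text \<open>The factor \<open>sqrt (exp 1)\<close> makes this
  \<open>exp ((1 - x\<^sup>2) / 2)\<close>, whose exponent is positive for
  \<open>\<bar>x\<bar> < 1\<close>.\<close>

lemma dPhi_gt_1:
  assumes "\<bar>x\<bar> < 1"
  shows "1 < dPhi x"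
proof -
  have "x\<^sup>2 < 1"
    using assms by (simp add: abs_square_less_1)
  moreover have "sqrt (exp 1) = exp (1 / 2 :: real)"
    by (rule real_sqrt_unique) (simp_all flip: exp_of_nat_mult)
  ultimately show ?thesis
    by (simp add: dPhi_def flip: exp_add)
qed

text \<open>The integrand is \<open>sqrt (2 * pi)\<close> times the standard normal density, which
  is Lebesgue integrable. Borel sets cover the half-lines as well as the compact intervals.\<close>

lemma integrable_gaussian_on:
  fixes S :: "real set"
  assumes "S \<in> sets borel"
  shows "(\<lambda>t::real. exp (- (t\<^sup>2) / 2)) integrable_on S"
proof -
  have "integrable lborel (\<lambda>t. sqrt (2 * pi) * std_normal_density t)"
    by simp
  then have "integrable lborel (\<lambda>t::real. exp (- (t\<^sup>2) / 2))"
    by (simp add: std_normal_density_def)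
  then have "set_integrable lborel S (\<lambda>t::real. exp (- (t\<^sup>2) / 2))"
    unfolding set_integrable_def using assms by (intro integrable_mult_indicator) auto
  then show ?thesis
    by (rule set_borel_integral_eq_integral)
qed

lemma Phi_nonneg: "0 \<le> Phi x"
  unfolding Phi_def by (intro mult_nonneg_nonneg integral_nonneg integrable_gaussian_on) auto

lemma Phi_has_real_derivative: "(Phi has_real_derivative dPhi x) (at x)"
proof -
  let ?g = "\<lambda>t::real. exp (- (t\<^sup>2) / 2)"
  \<comment> \<open>The fundamental theorem is applied on a compact interval around
    \<open>x\<close>; the integral over the half-line up to \<open>x - 1\<close> is a constant added
    afterwards.\<close>
  have "((\<lambda>y. integral {x - 1..y} ?g) has_real_derivative ?g x) (at x within {x - 1..x + 1})"
    by (rule integral_has_real_derivative) (auto intro!: continuous_intros)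
  then have "((\<lambda>y. integral {x - 1..y} ?g) has_real_derivative ?g x) (at x)"
    by (subst (asm) at_within_interior) auto
  then have "((\<lambda>y. sqrt (exp 1) * (integral {..x - 1} ?g + integral {x - 1..y} ?g))
      has_real_derivative dPhi x) (at x)"
    by (auto intro!: derivative_eq_intros simp: dPhi_def)
  then show ?thesis
  proof (rule has_field_derivative_transform_within_open[of _ _ _ "{x - 1<..}"])
    fix y assume "y \<in> {x - 1<..}"
    then have "{..y} = {..x - 1} \<union> {x - 1..y}" and "{..x - 1} \<inter> {x - 1..y} = {x - 1}"
      by auto
    then have "integral {..y} ?g = integral {..x - 1} ?g + integral {x - 1..y} ?g"
      by (metis integral_Un integrable_gaussian_on atMost_borel atLeastAtMost_borel negligible_sing)
    then show "sqrt (exp 1) * (integral {..x - 1} ?g + integral {x - 1..y} ?g) = Phi y"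
      by (simp add: Phi_def)
  qed auto
qed

section \<open>The function \<open>Gam\<close>\<close>

definition dGam :: "real \<Rightarrow> real" where
  "dGam x = (if x < 0 then - (1 - 1 / x) * exp (1 / x + 1) else 0)"

lemma dGam_0 [simp]: "dGam 0 = 0"
  by (simp add: dGam_def)

lemma dGam_nonpos: "dGam x \<le> 0"
  by (auto simp: dGam_def mult_le_0_iff divide_simps)

text \<open>Here \<open>1 / x\<close> lies in [-1, 0), so the exponential is at least 1 and
  \<open>1 - 1 / x\<close> exceeds 1.\<close>

lemma dGam_less_minus_1:
  assumes "x \<le> -1"
  shows "dGam x < -1"
proof -
  have "1 / x \<ge> -1"
    using assms by (simp add: divide_simps)
  then have "1 \<le> exp (1 / x + 1)"
    by simp
  moreover have "1 - 1 / x > 1"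
    using assms by simp
  ultimately have "1 * 1 < (1 - 1 / x) * exp (1 / x + 1)"
    by (intro mult_less_le_imp_less) auto
  then show ?thesis
    using assms by (simp add: dGam_def algebra_simps)
qed

lemma Gam_has_real_derivative: "(Gam has_real_derivative dGam x) (at x)"
proof (cases x "0 :: real" rule: linorder_cases)
  case less
  have "((\<lambda>x. - x * exp (1 / x + 1)) has_real_derivative dGam x) (at x)"
    using less
    by (auto intro!: derivative_eq_intros simp: dGam_def)
       (simp add: field_simps power2_eq_square)
  then show ?thesis
    by (rule has_field_derivative_transform_within_open[of _ _ _ "{..<0}"])
       (use less in \<open>auto simp: Gam_def\<close>)
next
  case equal
  \<comment> \<open>For \<open>y < 0\<close> the value is \<open>- y * exp (1 / y) * exp 1\<close>,
    and \<open>exp (1 / y) \<le> - y\<close> by the bound at \<open>s = - 1 / y\<close>.\<close>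
  have "\<bar>Gam y - Gam x\<bar> \<le> exp 1 * (y - x)\<^sup>2" for y
  proof (cases "y < 0")
    case True
    then have "exp (1 / y) \<le> - y"
      using exp_minus_le_inverse[of "- 1 / y"] by (simp add: divide_simps)
    then have "- y * exp (1 / y) * exp 1 \<le> - y * (- y) * exp 1"
      using True by (intro mult_right_mono mult_left_mono) auto
    moreover have "0 \<le> - y * exp (1 / y) * exp 1"
      using True by (intro mult_nonneg_nonneg) auto
    ultimately show ?thesis
      using True equal by (simp add: Gam_def exp_add power2_eq_square mult_ac)
  qed (use equal in \<open>simp add: Gam_def\<close>)
  then have "(Gam has_real_derivative 0) (at x)"
    by (rule has_real_derivative_0_if_quadratic_bound)
  then show ?thesis
    using equal by simp
next
  case greater
  have "((\<lambda>x. 0) has_real_derivative 0) (at x)"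
    by simp
  then have "(Gam has_real_derivative 0) (at x)"
    by (rule has_field_derivative_transform_within_open[of _ _ _ "{0<..}"])
       (use greater in \<open>auto simp: Gam_def\<close>)
  then show ?thesis
    using greater by (simp add: dGam_def)
qed

section \<open>Partial derivatives of \<open>F\<close>\<close>

text \<open>The adjoint of \<open>f'\<close> at 1 is the vector representing \<open>f'\<close> as an
  inner product, hence the gradient.\<close>

lemma gradient_nth:
  fixes f :: "real ^ 'n \<Rightarrow> real"
  assumes "(f has_derivative f') (at x)"
  shows "gradient f x $ i = f' (axis i 1)"
proof -
  have lin: "linear f'"
    using assms by (rule has_derivative_linear)
  have *: "h \<bullet> adjoint f' 1 = f' h" for h
    using adjoint_works[OF lin, of h 1] by simp
  have "GDERIV f x :> adjoint f' 1"
    using assms by (simp add: gderiv_def *)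
  then have "gradient f x = adjoint f' 1"
    by (rule gradient_eqI)
  then show ?thesis
    using *[of "axis i 1"] by (simp add: inner_axis')
qed

text \<open>The derivative of \<open>coord\<close> at index \<open>i\<close> in direction
  \<open>h\<close>; it is 0 for \<open>i \<le> 0\<close> since those coordinates are constantly
  1.\<close>

definition dcoord :: "int \<Rightarrow> real ^ 'n::{finite,linorder} \<Rightarrow> real" where
  "dcoord i h = (if i \<le> 0 then 0 else h $ idx (nat i))"

lemma coord_has_derivative:
  "((\<lambda>x. coord x i) has_derivative dcoord i) (at x)"
  by (cases "i \<le> 0")
     (auto simp: coord_def dcoord_def[abs_def] intro!: bounded_linear_imp_has_derivative)

lemma dcoord_axis_idx:
  assumes "j \<in> {1..CARD('n)}" "i \<le> int CARD('n)"
  shows "dcoord i (axis (idx j) 1 :: real ^ 'n::{finite,linorder}) = (if i = int j then 1 else 0)"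
proof (cases "i \<le> 0")
  case False
  have "idx (nat i) = (idx j :: 'n) \<longleftrightarrow> nat i = j"
    using bij_betw_imp_inj_on[OF bij_betw_idx] assms False by (intro inj_on_eq_iff) auto
  then show ?thesis
    using False by (auto simp: dcoord_def axis_def)
qed (use assms in \<open>auto simp: dcoord_def\<close>)

text \<open>The derivative is left in the form that the product and chain rules produce, so that
  applying these rules is the whole proof.\<close>

lemma F_has_derivative:
  fixes x :: "real ^ 'n::{finite,linorder}"
  assumes "1 < a"
  shows "(F K a has_derivative (\<lambda>h.
      - (\<Sum>i=1..CARD('n).
          (\<Prod>k=1..K. Psi a (coord x (int i - int k))) * (dcoord (int i) h * dPhi (coord x (int i)))
          + (\<Sum>k=1..K. dcoord (int i - int k) h * dPsi a (coord x (int i - int k))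
              * (\<Prod>l\<in>{1..K} - {k}. Psi a (coord x (int i - int l)))) * Phi (coord x (int i)))
      + (\<Sum>i=1..CARD('n). dcoord (int i) h * dGam (coord x (int i))))) (at x)"
  unfolding F_def[abs_def]
  by (intro has_derivative_add has_derivative_minus has_derivative_sum has_derivative_mult
      has_derivative_prod DERIV_compose_FDERIV coord_has_derivative
      Psi_has_real_derivative Phi_has_real_derivative Gam_has_real_derivative assms)

text \<open>\<open>R\<close> collects the terms in which a factor \<open>Psi\<close> is
  differentiated. Each contains \<open>dPsi\<close> at \<open>x\<^sub>j\<close> and otherwise
  nonnegative factors; only its sign and its vanishing matter later.\<close>

lemma gradient_F_nth:
  fixes x :: "real ^ 'n::{finite,linorder}"
  assumes "1 < a" "j \<in> {1..CARD('n)}"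
  obtains R where "R \<ge> 0"
    and "dPsi a (coord x (int j)) = 0 \<Longrightarrow> R = 0"
    and "gradient (F K a) x $ idx j =
      - (\<Prod>k=1..K. Psi a (coord x (int j - int k))) * dPhi (coord x (int j)) - R
      + dGam (coord x (int j))"
proof
  \<comment> \<open>The value of \<open>dcoord i\<close> at the \<open>j\<close>-th unit
    vector.\<close>
  let ?d = "\<lambda>i. if i = int j then 1 else 0 :: real"
  let ?R = "\<lambda>i. (\<Sum>k=1..K. ?d (int i - int k) * dPsi a (coord x (int i - int k))
              * (\<Prod>l\<in>{1..K} - {k}. Psi a (coord x (int i - int l)))) * Phi (coord x (int i))"
  show "(\<Sum>i=1..CARD('n). ?R i) \<ge> 0"
    by (intro sum_nonneg mult_nonneg_nonneg prod_nonneg dPsi_nonneg Psi_nonneg Phi_nonneg assms) auto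
  show "(\<Sum>i=1..CARD('n). ?R i) = 0" if "dPsi a (coord x (int j)) = 0"
    using that by (intro sum.neutral ballI) (auto intro!: sum.neutral)
  have sum_d: "(\<Sum>i=1..CARD('n). P i * (?d (int i) * Q i)) = P j * Q j" for P Q
  proof -
    have "(\<Sum>i=1..CARD('n). P i * (?d (int i) * Q i)) =
        (\<Sum>i=1..CARD('n). if i = j then P i * Q i else 0)"
      by (intro sum.cong) auto
    then show ?thesis
      using assms(2) by simp
  qed
  have "gradient (F K a) x $ idx j =
      - (\<Sum>i=1..CARD('n). (\<Prod>k=1..K. Psi a (coord x (int i - int k))) * (?d (int i) * dPhi (coord x (int i)))
          + ?R i)
      + (\<Sum>i=1..CARD('n). ?d (int i) * dGam (coord x (int i)))"
    unfolding gradient_nth[OF F_has_derivative[OF assms(1)]]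
    by (intro refl arg_cong2[where f = plus] arg_cong2[where f = times] arg_cong[where f = uminus]
        sum.cong dcoord_axis_idx assms(2)) auto
  also have "\<dots> = - (\<Prod>k=1..K. Psi a (coord x (int j - int k))) * dPhi (coord x (int j))
      - (\<Sum>i=1..CARD('n). ?R i) + dGam (coord x (int j))"
    by (simp only: sum.distrib sum_d sum_d[of "\<lambda>_. 1", simplified mult_1]
        mult_minus_left diff_conv_add_uminus minus_add_distrib)
  finally show "gradient (F K a) x $ idx j =
      - (\<Prod>k=1..K. Psi a (coord x (int j - int k))) * dPhi (coord x (int j))
      - (\<Sum>i=1..CARD('n). ?R i) + dGam (coord x (int j))" .
qed

section \<open>Support and norm of the gradient\<close>

text \<open>Used in contrapositive form: an index in 0, ..., T beyond \<open>prog\<close> has a zero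
  among the \<open>K\<close> coordinates ending there.\<close>

lemma prog_ge:
  fixes x :: "real ^ 'n::{finite,linorder}"
  assumes "i \<le> CARD('n)" "\<And>k. k < K \<Longrightarrow> coord x (int i - int k) \<noteq> 0"
  shows "i \<le> prog K x"
  unfolding prog_def using assms by (intro Max_ge) auto

text \<open>Differentiability is part of the conclusion because \<open>gradient\<close> is a
  definite description, which denotes the gradient only where one exists.\<close>

theorem lemma3p1:
  fixes K :: nat and a :: real and x :: "real ^ 'n::{finite,linorder}"
  assumes "K \<ge> 1" and "1 < a" and "a \<le> exp 1"
  shows "F K a differentiable (at x)
    \<and> supp (gradient (F K a) x) \<subseteq> {1..prog K x + 1} \<union> supp x
    \<and> (prog K x < CARD('n) \<longrightarrow> norm (gradient (F K a) x) > 1)"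
proof (intro conjI impI)
  show "F K a differentiable (at x)"
    using F_has_derivative[OF assms(2)] unfolding differentiable_def by blast
  show "supp (gradient (F K a) x) \<subseteq> {1..prog K x + 1} \<union> supp x"
  proof
    fix j assume "j \<in> supp (gradient (F K a) x)"
    then have j: "j \<in> {1..CARD('n)}" and nz: "gradient (F K a) x $ idx j \<noteq> 0"
      by (auto simp: supp_def)
    show "j \<in> {1..prog K x + 1} \<union> supp x"
    proof (rule ccontr)
      assume not: "\<not> ?thesis"
      \<comment> \<open>The shift to \<open>j - 1\<close> is what fits: the \<open>K\<close>
        coordinates ending at \<open>j - 1\<close> are exactly the arguments of the factors
        \<open>Psi\<close> in front of \<open>Phi\<close> at \<open>x\<^sub>j\<close>.\<close>
      then have "\<not> j - 1 \<le> prog K x" and "j - 1 \<le> CARD('n)"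
        using j by auto
      then obtain k where k: "k < K" "coord x (int (j - 1) - int k) = 0"
        using prog_ge by blast
      then have "coord x (int j - int (Suc k)) = 0"
        using j by (simp add: of_nat_diff algebra_simps)
      then have "(\<Prod>k=1..K. Psi a (coord x (int j - int k))) = 0"
        using k(1) by (intro prod_zero bexI[of _ "Suc k"]) auto
      moreover have "coord x (int j) = 0"
        using not j by (auto simp: supp_def coord_def)
      ultimately show False
        using nz gradient_F_nth[OF assms(2) j, of x K]
        by (metis dPsi_0 dGam_0 add_0 diff_zero minus_zero mult_zero_left)
    qed
  qed
next
  assume "prog K x < CARD('n)"
  then obtain k where k: "coord x (int CARD('n) - int k) = 0"
    using prog_ge[of "CARD('n)" K x] by force
  \<comment> \<open>The zero sits at a positive index, since the convention gives the value 1 at all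
    others.\<close>
  then have "k < CARD('n)"
    by (rule contrapos_pp) (simp add: coord_def)
  with k have "CARD('n) - k \<in> {1..CARD('n)} \<and> coord x (int (CARD('n) - k)) < 1"
    by (simp add: of_nat_diff)
  \<comment> \<open>The zero only ensures that some coordinate is below 1. The first such one is
    taken, not the first zero: an earlier coordinate in (0, 1) could make a factor
    \<open>Psi\<close> small.\<close>
  then obtain j where j: "j \<in> {1..CARD('n)}" "coord x (int j) < 1"
    and least: "\<And>i. i < j \<Longrightarrow> \<not> (i \<in> {1..CARD('n)} \<and> coord x (int i) < 1)"
    using exists_least_iff[of "\<lambda>j. j \<in> {1..CARD('n)} \<and> coord x (int j) < 1"] by auto
  \<comment> \<open>Positive indices are covered by minimality of \<open>j\<close>, the remaining
    ones by the convention.\<close>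
  have ge_1: "1 \<le> coord x (int j - int k)" if "k \<ge> 1" for k
  proof (cases "k < j")
    case True
    then have "j - k < j" "j - k \<in> {1..CARD('n)}"
      using j that by auto
    then show ?thesis
      using least[of "j - k"] True by (simp add: of_nat_diff)
  qed (simp add: coord_def)
  have "1 \<le> (\<Prod>k=1..K. Psi a (coord x (int j - int k)))"
    using ge_1 assms(2) by (intro prod_ge_1 Psi_ge_1) auto
  then have *: "dPhi (coord x (int j)) \<le>
      (\<Prod>k=1..K. Psi a (coord x (int j - int k))) * dPhi (coord x (int j))"
    using mult_right_mono[OF _ dPhi_nonneg] by fastforce
  have "1 < dPhi (coord x (int j)) - dGam (coord x (int j))"
  proof (cases "coord x (int j) \<le> -1")
    case True
    then show ?thesis
      using dGam_less_minus_1[OF True] dPhi_nonneg[of "coord x (int j)"] by simp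
  next
    case False
    then have "1 < dPhi (coord x (int j))"
      using j(2) by (intro dPhi_gt_1) auto
    then show ?thesis
      using dGam_nonpos[of "coord x (int j)"] by simp
  qed
  moreover obtain R where "R \<ge> 0" "gradient (F K a) x $ idx j =
      - (\<Prod>k=1..K. Psi a (coord x (int j - int k))) * dPhi (coord x (int j)) - R
      + dGam (coord x (int j))"
    using gradient_F_nth[OF assms(2) j(1)] by metis
  ultimately have "1 < \<bar>gradient (F K a) x $ idx j\<bar>"
    using * by simp
  also have "\<dots> \<le> norm (gradient (F K a) x)"
    by (rule component_le_norm_cart)
  finally show "1 < norm (gradient (F K a) x)" .
qed

end
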